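(* Let $\gamma$ be a germ of a smooth convex curve in the Euclidean plane $\mathbb{R}^2$. Assume that $\gamma$ admits a non-vanishing normal vector field $N$ such that for all points $x,y\in\gamma$ one has $$ N(x)\cdot (y-x) = -N(y)\cdot (y-x). $$ Then $\gamma$ is a germ of a conic.
   Context: The dot denotes the Euclidean scalar product in $\mathbb{R}^2$. A germ of a curve is a (sufficiently small) arc of a curve, not necessarily closed. A normal vector field along $\gamma$ assigns to each $x\in\gamma$ a vector $N(x)\in\mathbb{R}^2$ orthogonal to the tangent line of $\gamma$ at $x$; it is not assumed to have unit length. A conic is a plane curve given by a polynomial equation of degree two, and a germ of a conic is an arc contained in such a curve. *)

theory Defs
  imports "HOL-Analysis.Analysis"
begin

text \<open>
  A germ of a curve is represented by a parametrisation \<open>\<gamma>\<close> on a nondegenerate interval \<open>I\<close>,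
  which may contain none, one or both of its end points. Derivatives are taken within \<open>I\<close>,
  so they are one-sided at end points belonging to \<open>I\<close>.
\<close>

definition velocity :: "real set \<Rightarrow> (real \<Rightarrow> real^2) \<Rightarrow> real \<Rightarrow> real^2" where
  "velocity I \<gamma> t = vector_derivative \<gamma> (at t within I)"

definition smooth_arc :: "real set \<Rightarrow> (real \<Rightarrow> real^2) \<Rightarrow> bool" where
  "smooth_arc I \<gamma> \<longleftrightarrow>
     is_interval I \<and> interior I \<noteq> {} \<and>
     (\<forall>n. (velocity I ^^ n) \<gamma> differentiable_on I) \<and>
     (\<forall>t\<in>I. velocity I \<gamma> t \<noteq> 0) \<and>
     inj_on \<gamma> I"

text \<open>
  Convexity in the usual sense for regular plane curves: at every point the curve lies in one
  of the two closed half-planes bounded by the tangent line. Neither strict convexity nor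
  nonvanishing curvature is required.
\<close>

definition convex_arc :: "real set \<Rightarrow> (real \<Rightarrow> real^2) \<Rightarrow> bool" where
  "convex_arc I \<gamma> \<longleftrightarrow>
     (\<forall>t\<in>I. \<exists>\<nu>. \<nu> \<noteq> 0 \<and> orthogonal \<nu> (velocity I \<gamma> t) \<and> (\<forall>s\<in>I. 0 \<le> \<nu> \<bullet> (\<gamma> s - \<gamma> t)))"

text \<open>No continuity of the field is assumed.\<close>

definition normal_field :: "real set \<Rightarrow> (real \<Rightarrow> real^2) \<Rightarrow> (real^2 \<Rightarrow> real^2) \<Rightarrow> bool" where
  "normal_field I \<gamma> N \<longleftrightarrow> (\<forall>t\<in>I. orthogonal (N (\<gamma> t)) (velocity I \<gamma> t))"

text \<open>Degenerate conics are included; only the degree of the polynomial is prescribed.\<close>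

definition plane_conic :: "(real^2) set \<Rightarrow> bool" where
  "plane_conic K \<longleftrightarrow>
     (\<exists>a b c d e f. (a \<noteq> 0 \<or> b \<noteq> 0 \<or> c \<noteq> 0) \<and>
        K = {p. a * (p$1)^2 + b * (p$1) * (p$2) + c * (p$2)^2 + d * (p$1) + e * (p$2) + f = 0})"

end

theory Submission
  imports Defs
begin

text \<open>
  Put \<open>\<beta>(x,y) = N(x) \<bullet> (y - x)\<close> for points \<open>x, y\<close> of the curve. The hypothesis says precisely that
  \<open>\<beta>\<close> is symmetric. By construction \<open>\<beta>\<close> is affine in \<open>y\<close> and vanishes on the diagonal; symmetry
  makes it affine in \<open>x\<close> as well, so \<open>\<beta>(x,x) = 0\<close> is a quadratic equation for the points \<open>x\<close> of
  the curve.

  To make this explicit, suppose that the curve contains an affine frame \<open>p\<^sub>0, p\<^sub>1, p\<^sub>2\<close> and let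
  \<open>\<lambda>\<^sub>0, \<lambda>\<^sub>1, \<lambda>\<^sub>2\<close> be the barycentric coordinates of \<open>x\<close>. Expanding \<open>\<beta>(x,x)\<close> in both arguments gives
  \<open>\<lambda>\<^sub>0 \<lambda>\<^sub>1 \<beta>(p\<^sub>0,p\<^sub>1) + \<lambda>\<^sub>0 \<lambda>\<^sub>2 \<beta>(p\<^sub>0,p\<^sub>2) + \<lambda>\<^sub>1 \<lambda>\<^sub>2 \<beta>(p\<^sub>1,p\<^sub>2) = 0\<close>. If the quadratic part of this
  equation vanished, then \<open>\<beta>(p\<^sub>0,p\<^sub>1) = \<beta>(p\<^sub>0,p\<^sub>2) = 0\<close>, so \<open>N(p\<^sub>0)\<close> would be orthogonal to two
  independent vectors and hence zero. If the curve contains no affine frame, it lies on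
  a line, and the square of the equation of that line defines a conic.
\<close>

text \<open>
  An affine change of coordinates keeps the degree at two. If the quadratic part in \<open>p$1, p$2\<close>
  vanished, so would its values at \<open>(\<delta>, - \<gamma>)\<close> and \<open>(- \<beta>, \<alpha>)\<close> and its discriminant; up to the
  factor \<open>(\<alpha> \<delta> - \<beta> \<gamma>)\<^sup>2\<close> these are \<open>A\<close>, \<open>C\<close> and \<open>B\<^sup>2 - 4 A C\<close>.
\<close>

lemma plane_conic_affine_coordinates:
  fixes \<alpha> \<beta> \<mu> \<gamma> \<delta> \<nu> A B C D E F :: real
  defines "U \<equiv> \<lambda>p :: real^2. \<alpha> * p$1 + \<beta> * p$2 + \<mu>"
    and "V \<equiv> \<lambda>p :: real^2. \<gamma> * p$1 + \<delta> * p$2 + \<nu>"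
  assumes indep: "\<alpha> * \<delta> - \<beta> * \<gamma> \<noteq> 0"
    and nz: "A \<noteq> 0 \<or> B \<noteq> 0 \<or> C \<noteq> 0"
  shows "plane_conic {p. A * (U p)^2 + B * U p * V p + C * (V p)^2 + D * U p + E * V p + F = 0}"
proof -
  define a where "a = A * \<alpha>^2 + B * \<alpha> * \<gamma> + C * \<gamma>^2"
  define b where "b = 2 * A * \<alpha> * \<beta> + B * (\<alpha> * \<delta> + \<beta> * \<gamma>) + 2 * C * \<gamma> * \<delta>"
  define c where "c = A * \<beta>^2 + B * \<beta> * \<delta> + C * \<delta>^2"
  define d where "d = 2 * A * \<alpha> * \<mu> + B * (\<alpha> * \<nu> + \<gamma> * \<mu>) + 2 * C * \<gamma> * \<nu> + D * \<alpha> + E * \<gamma>"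
  define e where "e = 2 * A * \<beta> * \<mu> + B * (\<beta> * \<nu> + \<delta> * \<mu>) + 2 * C * \<delta> * \<nu> + D * \<beta> + E * \<delta>"
  define f where "f = A * \<mu>^2 + B * \<mu> * \<nu> + C * \<nu>^2 + D * \<mu> + E * \<nu> + F"
  have expand: "A * (U p)^2 + B * U p * V p + C * (V p)^2 + D * U p + E * V p + F
      = a * (p$1)^2 + b * (p$1) * (p$2) + c * (p$2)^2 + d * (p$1) + e * (p$2) + f" for p
    by (simp add: U_def V_def a_def b_def c_def d_def e_def f_def algebra_simps power2_eq_square)
  have "a \<noteq> 0 \<or> b \<noteq> 0 \<or> c \<noteq> 0"
  proof (rule ccontr)
    assume "\<not> ?thesis"
    then have zero: "a = 0" "b = 0" "c = 0"
      by auto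
    have "A * (\<alpha> * \<delta> - \<beta> * \<gamma>)^2 = a * \<delta>^2 - b * \<gamma> * \<delta> + c * \<gamma>^2"
      by (simp add: a_def b_def c_def algebra_simps power2_eq_square)
    moreover have "C * (\<alpha> * \<delta> - \<beta> * \<gamma>)^2 = a * \<beta>^2 - b * \<alpha> * \<beta> + c * \<alpha>^2"
      by (simp add: a_def b_def c_def algebra_simps power2_eq_square)
    moreover have "(B^2 - 4 * A * C) * (\<alpha> * \<delta> - \<beta> * \<gamma>)^2 = b^2 - 4 * a * c"
      by (simp add: a_def b_def c_def algebra_simps power2_eq_square)
    ultimately show False
      using indep nz zero by auto
  qed
  then show ?thesis
    unfolding plane_conic_def expand by blast
qed

definition det2 :: "real^2 \<Rightarrow> real^2 \<Rightarrow> real" where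
  "det2 v w = v$1 * w$2 - v$2 * w$1"

lemma det2_cramer: "det2 v w *\<^sub>R z = det2 z w *\<^sub>R v + det2 v z *\<^sub>R w"
  by (simp add: vec_eq_iff forall_2 det2_def algebra_simps)

lemma orthogonal_basis_imp_zero:
  assumes "det2 v w \<noteq> 0" "n \<bullet> v = 0" "n \<bullet> w = 0"
  shows "n = 0"
proof -
  have "det2 v w * (n \<bullet> n) = n \<bullet> (det2 v w *\<^sub>R n)"
    by simp
  also have "\<dots> = 0"
    unfolding det2_cramer[of v w n] by (simp add: inner_add_right assms)
  finally show ?thesis
    using assms(1) by simp
qed

text \<open>
  A line is the zero set of the square of its equation, which is of degree two. That equation is
  completed to an affine coordinate system by the coordinate \<open>w \<bullet> (p - x)\<close> along the line.
\<close>

lemma line_subset_plane_conic: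
  assumes "w \<noteq> 0" and "\<forall>p\<in>S. det2 w (p - x) = 0"
  shows "\<exists>K. plane_conic K \<and> S \<subseteq> K"
proof -
  define U where "U = (\<lambda>p :: real^2. (- (w$2)) * p$1 + w$1 * p$2 + (w$2 * x$1 - w$1 * x$2))"
  define V where "V = (\<lambda>p :: real^2. w$1 * p$1 + w$2 * p$2 + - (w \<bullet> x))"
  have "w$1 \<noteq> 0 \<or> w$2 \<noteq> 0"
    using assms(1) by (auto simp: vec_eq_iff forall_2)
  then have "w$1 * w$1 + w$2 * w$2 \<noteq> 0"
    by (simp add: sum_squares_eq_zero_iff)
  then have "(- (w$2)) * w$2 - w$1 * w$1 \<noteq> 0"
    by (simp del: sum_squares_eq_zero_iff)
  from plane_conic_affine_coordinates[OF this, of 1 0 0 "w$2 * x$1 - w$1 * x$2" "- (w \<bullet> x)" 0 0 0]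
  have "plane_conic {p. (U p)^2 = 0}"
    by (simp add: U_def)
  moreover have "U p = det2 w (p - x)" for p
    by (simp add: U_def det2_def algebra_simps)
  then have "S \<subseteq> {p. (U p)^2 = 0}"
    using assms(2) by auto
  ultimately show ?thesis
    by blast
qed

text \<open>
  The quadratic equation itself, with the barycentric coordinates of \<open>x\<close> in the frame \<open>p, q, r\<close>
  multiplied by \<open>det2 (q - p) (r - p)\<close> in order to avoid division.
\<close>

lemma circumscribed_conic_equation:
  fixes p q r x :: "real^2" and N :: "real^2 \<Rightarrow> real^2"
  defines "\<Delta> \<equiv> det2 (q - p) (r - p)" and "U \<equiv> det2 (x - p) (r - p)" and "V \<equiv> det2 (q - p) (x - p)"
  assumes sym: "\<And>y z. y \<in> {p, q, r, x} \<Longrightarrow> z \<in> {p, q, r, x} \<Longrightarrow> N y \<bullet> (z - y) = N z \<bullet> (y - z)"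
  shows "(\<Delta> - U - V) * U * (N p \<bullet> (q - p)) + (\<Delta> - U - V) * V * (N p \<bullet> (r - p))
           + U * V * (N q \<bullet> (r - q)) = 0"
proof -
  define W where "W = \<Delta> - U - V"
  \<comment> \<open>Affine functions are determined by their values on the frame.\<close>
  have bary: "\<Delta> * (n \<bullet> (x - y)) = W * (n \<bullet> (p - y)) + U * (n \<bullet> (q - y)) + V * (n \<bullet> (r - y))" for n y
  proof -
    have "\<Delta> *\<^sub>R (x - y) = \<Delta> *\<^sub>R (x - p) + \<Delta> *\<^sub>R (p - y)"
      by (simp add: algebra_simps)
    also have "\<Delta> *\<^sub>R (x - p) = U *\<^sub>R (q - p) + V *\<^sub>R (r - p)"
      unfolding \<Delta>_def U_def V_def by (rule det2_cramer)
    finally have "\<Delta> *\<^sub>R (x - y) = W *\<^sub>R (p - y) + U *\<^sub>R (q - y) + V *\<^sub>R (r - y)"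
      by (simp add: W_def algebra_simps)
    then have "n \<bullet> (\<Delta> *\<^sub>R (x - y)) = n \<bullet> (W *\<^sub>R (p - y) + U *\<^sub>R (q - y) + V *\<^sub>R (r - y))"
      by (rule arg_cong)
    then show ?thesis
      by (simp only: inner_add_right inner_scaleR_right)
  qed
  have "0 = \<Delta> * (\<Delta> * (N x \<bullet> (x - x)))"
    by simp
  also have "\<dots> = \<Delta> * (W * (N x \<bullet> (p - x)) + U * (N x \<bullet> (q - x)) + V * (N x \<bullet> (r - x)))"
    by (simp only: bary)
  also have "\<dots> = W * (\<Delta> * (N p \<bullet> (x - p))) + U * (\<Delta> * (N q \<bullet> (x - q))) + V * (\<Delta> * (N r \<bullet> (x - r)))"
    by (simp add: sym[of x] algebra_simps del: inner_diff_right)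
  also have "\<dots> = W * (U * (N p \<bullet> (q - p)) + V * (N p \<bullet> (r - p)))
      + U * (W * (N p \<bullet> (q - p)) + V * (N q \<bullet> (r - q)))
      + V * (W * (N p \<bullet> (r - p)) + U * (N q \<bullet> (r - q)))"
    by (simp only: bary) (simp add: sym[of q p] sym[of r p] sym[of r q])
  also have "\<dots> = 2 * (W * U * (N p \<bullet> (q - p)) + W * V * (N p \<bullet> (r - p)) + U * V * (N q \<bullet> (r - q)))"
    by (simp only: distrib_left mult_2 mult_ac add_ac)
  finally show ?thesis
    by (simp add: W_def)
qed

text \<open>
  Writing the circumscribed conic in the affine coordinates \<open>U, V\<close>, its quadratic part has
  coefficients \<open>- b\<^sub>1\<close>, \<open>b - b\<^sub>1 - b\<^sub>2\<close> and \<open>- b\<^sub>2\<close>, where \<open>b\<^sub>1\<close> and \<open>b\<^sub>2\<close> are the products of \<open>N p\<close>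
  with the two edges of the frame at \<open>p\<close>; these do not both vanish.
\<close>

lemma symmetric_field_subset_plane_conic:
  fixes S :: "(real^2) set" and N :: "real^2 \<Rightarrow> real^2"
  assumes nz: "\<And>x. x \<in> S \<Longrightarrow> N x \<noteq> 0"
    and sym: "\<And>x y. x \<in> S \<Longrightarrow> y \<in> S \<Longrightarrow> N x \<bullet> (y - x) = N y \<bullet> (x - y)"
  shows "\<exists>K. plane_conic K \<and> S \<subseteq> K"
proof (cases "\<exists>p\<in>S. \<exists>q\<in>S. \<exists>r\<in>S. det2 (q - p) (r - p) \<noteq> 0")
  case True
  then obtain p q r where S: "p \<in> S" "q \<in> S" "r \<in> S" and frame: "det2 (q - p) (r - p) \<noteq> 0"
    by blast
  define \<Delta> where "\<Delta> = det2 (q - p) (r - p)"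
  define \<alpha> \<beta> \<mu> where "\<alpha> = (r - p)$2" and "\<beta> = - ((r - p)$1)" and "\<mu> = - det2 p (r - p)"
  define \<gamma> \<delta> \<nu> where "\<gamma> = - ((q - p)$2)" and "\<delta> = (q - p)$1" and "\<nu> = - det2 (q - p) p"
  define U where "U = (\<lambda>x :: real^2. \<alpha> * x$1 + \<beta> * x$2 + \<mu>)"
  define V where "V = (\<lambda>x :: real^2. \<gamma> * x$1 + \<delta> * x$2 + \<nu>)"
  define b1 b2 b where "b1 = N p \<bullet> (q - p)" and "b2 = N p \<bullet> (r - p)" and "b = N q \<bullet> (r - q)"
  have U: "U x = det2 (x - p) (r - p)" for x
    by (simp add: U_def \<alpha>_def \<beta>_def \<mu>_def det2_def algebra_simps)
  have V: "V x = det2 (q - p) (x - p)" for x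
    by (simp add: V_def \<gamma>_def \<delta>_def \<nu>_def det2_def algebra_simps)
  have indep: "\<alpha> * \<delta> - \<beta> * \<gamma> \<noteq> 0"
    using frame by (simp add: \<alpha>_def \<beta>_def \<gamma>_def \<delta>_def det2_def algebra_simps)
  have "b1 \<noteq> 0 \<or> b2 \<noteq> 0"
    using orthogonal_basis_imp_zero[OF frame] nz[OF S(1)] by (auto simp: b1_def b2_def)
  then have "- b1 \<noteq> 0 \<or> b - b1 - b2 \<noteq> 0 \<or> - b2 \<noteq> 0"
    by auto
  from plane_conic_affine_coordinates[OF indep this, of \<mu> \<nu> "\<Delta> * b1" "\<Delta> * b2" 0]
  have "plane_conic {x. - b1 * (U x)^2 + (b - b1 - b2) * U x * V x + - b2 * (V x)^2
      + \<Delta> * b1 * U x + \<Delta> * b2 * V x + 0 = 0}"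
    unfolding U_def V_def .
  moreover have "- b1 * (U x)^2 + (b - b1 - b2) * U x * V x + - b2 * (V x)^2
      + \<Delta> * b1 * U x + \<Delta> * b2 * V x + 0 = 0" if "x \<in> S" for x
  proof -
    have "(\<Delta> - U x - V x) * U x * b1 + (\<Delta> - U x - V x) * V x * b2 + U x * V x * b = 0"
      unfolding U V \<Delta>_def b1_def b2_def b_def
      by (rule circumscribed_conic_equation) (use sym S that in blast)
    then show ?thesis
      by (simp add: algebra_simps power2_eq_square)
  qed
  ultimately show ?thesis
    by blast
next
  case False
  show ?thesis
  proof (cases "\<exists>p\<in>S. \<exists>q\<in>S. p \<noteq> q")
    case True
    then obtain p q where "p \<in> S" "q \<in> S" "q - p \<noteq> 0"
      by auto
    with False show ?thesis
      by (intro line_subset_plane_conic[of "q - p" S p]) auto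
  next
    case False
    \<comment> \<open>At most one point: any line through it will do.\<close>
    then obtain p where "S \<subseteq> {p}"
      by blast
    then show ?thesis
      by (intro line_subset_plane_conic[of "axis 1 1" S p]) (auto simp: det2_def axis_eq_0_iff)
  qed
qed

theorem theorem1:
  fixes I :: "real set" and \<gamma> :: "real \<Rightarrow> real^2" and N :: "real^2 \<Rightarrow> real^2"
  assumes "smooth_arc I \<gamma>"
    and "convex_arc I \<gamma>"
    and "normal_field I \<gamma> N"
    and "\<forall>x\<in>\<gamma> ` I. N x \<noteq> 0"
    and "\<forall>x\<in>\<gamma> ` I. \<forall>y\<in>\<gamma> ` I. N x \<bullet> (y - x) = - (N y \<bullet> (y - x))"
  shows "\<exists>K. plane_conic K \<and> \<gamma> ` I \<subseteq> K"
proof (rule symmetric_field_subset_plane_conic[where N = N])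
  show "N x \<noteq> 0" if "x \<in> \<gamma> ` I" for x
    using assms(4) that by blast
  show "N x \<bullet> (y - x) = N y \<bullet> (x - y)" if "x \<in> \<gamma> ` I" "y \<in> \<gamma> ` I" for x y
  proof -
    have "N x \<bullet> (y - x) = - (N y \<bullet> (y - x))"
      using assms(5) that by blast
    then show ?thesis
      by (simp add: inner_diff_right)
  qed
qed

end
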